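(* Every nonzero Turing degree contains a set $A \subseteq \omega$ which is not coarsely computable.
   Context: $\omega = \{0,1,2,\dots\}$. The density of $S \subseteq \omega$ is $\rho(S) = \lim_{n\to\infty} \frac{|S \cap [0,n]|}{n+1}$, when this limit exists. A set $A \subseteq \omega$ is coarsely computable if there is a computable set $C \subseteq \omega$ such that the symmetric difference $A \triangle C$ has density $0$. A Turing degree is nonzero if it is not the degree of the computable sets. *)

theory Defs
  imports Complex_Main
begin

section \<open>Relative computability\<close>

text \<open>
  Kleene's schemes for the partial recursive functions relative to an oracle. In \<open>Rec f g\<close> and
  \<open>Mu f\<close> the recursion variable, respectively the variable that is searched over, is the first
  argument.
\<close>

datatype recf =
    Zero
  | Succ
  | Proj nat
  | Oracle
  | Comp recf "recf list"
  | Rec recf recf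
  | Mu recf

text \<open>
  \<open>eval A e xs y\<close> says that the partial function with code \<open>e\<close> and oracle \<open>A\<close> is defined at the
  argument tuple \<open>xs\<close> and has value \<open>y\<close> there. Arities are not tracked: \<open>Zero\<close> and \<open>Proj i\<close> stand for
  the constant and the projection of every suitable arity, and where no rule applies the function
  is undefined.
\<close>

inductive eval :: "nat set \<Rightarrow> recf \<Rightarrow> nat list \<Rightarrow> nat \<Rightarrow> bool" for A :: "nat set" where
  eval_Zero: "eval A Zero xs 0"
| eval_Succ: "eval A Succ [x] (Suc x)"
| eval_Proj: "i < length xs \<Longrightarrow> eval A (Proj i) xs (xs ! i)"
| eval_Oracle: "eval A Oracle [x] (of_bool (x \<in> A))"
| eval_Comp: "list_all2 (\<lambda>g y. eval A g xs y) gs ys \<Longrightarrow> eval A f ys z \<Longrightarrow> eval A (Comp f gs) xs z"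
| eval_Rec_0: "eval A f xs y \<Longrightarrow> eval A (Rec f g) (0 # xs) y"
| eval_Rec_Suc: "eval A (Rec f g) (n # xs) y \<Longrightarrow> eval A g (n # y # xs) z
    \<Longrightarrow> eval A (Rec f g) (Suc n # xs) z"
| eval_Mu: "eval A f (n # xs) 0 \<Longrightarrow> \<forall>m<n. \<exists>y. eval A f (m # xs) (Suc y) \<Longrightarrow> eval A (Mu f) xs n"

inductive_cases eval_ZeroE: "eval A Zero xs y"
inductive_cases eval_SuccE: "eval A Succ xs y"
inductive_cases eval_ProjE: "eval A (Proj i) xs y"
inductive_cases eval_OracleE: "eval A Oracle xs y"
inductive_cases eval_CompE: "eval A (Comp f gs) xs y"
inductive_cases eval_Rec_0E: "eval A (Rec f g) (0 # xs) y"
inductive_cases eval_Rec_SucE: "eval A (Rec f g) (Suc n # xs) y"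
inductive_cases eval_MuE: "eval A (Mu f) xs y"

lemma eval_deterministic: "eval A e xs y \<Longrightarrow> eval A e xs z \<Longrightarrow> y = z"
proof (induction arbitrary: z rule: eval.induct)
  case (eval_Comp xs gs ys f v)
  from eval_Comp.prems obtain ys' where ys':
    "list_all2 (\<lambda>g y. eval A g xs y) gs ys'" "eval A f ys' z"
    by (rule eval_CompE)
  have "ys = ys'"
    using eval_Comp.IH(1) ys'(1) by (auto simp: list_all2_conv_all_nth intro!: nth_equalityI)
  with eval_Comp.IH(2) ys'(2) show ?case by simp
next
  case (eval_Rec_Suc f g n xs y v)
  from eval_Rec_Suc.prems obtain y' where y': "eval A (Rec f g) (n # xs) y'" "eval A g (n # y' # xs) z"
    by (rule eval_Rec_SucE)
  from eval_Rec_Suc.IH(1)[OF y'(1)] y'(2) have "eval A g (n # y # xs) z" by simp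
  then show ?case by (rule eval_Rec_Suc.IH(2))
next
  case (eval_Mu f n xs)
  from eval_Mu.prems have z: "eval A f (z # xs) 0" "\<forall>m<z. \<exists>y. eval A f (m # xs) (Suc y)"
    by (blast elim: eval_MuE)+
  have "\<not> n < z"
  proof
    assume "n < z"
    with z(2) obtain v where "eval A f (n # xs) (Suc v)" by blast
    from eval_Mu.IH(1)[OF this] show False by simp
  qed
  moreover have "\<not> z < n"
  proof
    assume "z < n"
    with eval_Mu.IH(2) obtain v where "\<forall>u. eval A f (z # xs) u \<longrightarrow> Suc v = u" by blast
    with z(1) show False by blast
  qed
  ultimately show ?case by simp
next
  case (eval_Rec_0 f xs y g)
  from eval_Rec_0.prems have "eval A f xs z" by (rule eval_Rec_0E)
  then show ?case by (rule eval_Rec_0.IH)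
qed (auto elim: eval_ZeroE eval_SuccE eval_ProjE eval_OracleE)

definition decides :: "nat set \<Rightarrow> recf \<Rightarrow> nat set \<Rightarrow> bool" where
  "decides A e B \<longleftrightarrow> (\<forall>x. eval A e [x] (of_bool (x \<in> B)))"

definition turing_reducible :: "nat set \<Rightarrow> nat set \<Rightarrow> bool" (infix \<open>\<le>\<^sub>T\<close> 50) where
  "B \<le>\<^sub>T A \<longleftrightarrow> (\<exists>e. decides A e B)"

fun oracle_free :: "recf \<Rightarrow> bool" where
  "oracle_free Oracle \<longleftrightarrow> False"
| "oracle_free (Comp f gs) \<longleftrightarrow> oracle_free f \<and> (\<forall>g\<in>set gs. oracle_free g)"
| "oracle_free (Rec f g) \<longleftrightarrow> oracle_free f \<and> oracle_free g"
| "oracle_free (Mu f) \<longleftrightarrow> oracle_free f"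
| "oracle_free _ \<longleftrightarrow> True"

text \<open>
  For a code without \<open>Oracle\<close> the oracle plays no role (\<open>eval_oracle_free\<close> below); the empty set
  serves as a dummy.
\<close>

definition computable :: "nat set \<Rightarrow> bool" where
  "computable C \<longleftrightarrow> (\<exists>e. oracle_free e \<and> decides {} e C)"

lemma eval_oracle_free: "eval A e xs y \<Longrightarrow> oracle_free e \<Longrightarrow> eval B e xs y"
proof (induction rule: eval.induct)
  case (eval_Comp xs gs ys f z)
  then have "list_all2 (\<lambda>g y. eval B g xs y) gs ys"
    by (auto simp: list_all2_conv_all_nth)
  with eval_Comp show ?case by (auto intro: eval.eval_Comp)
next
  case (eval_Mu f n xs)
  then have "\<forall>m<n. \<exists>y. eval B f (m # xs) (Suc y)" by fastforce
  with eval_Mu show ?case by (auto intro: eval.eval_Mu)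
qed (auto intro: eval.intros)

fun subst_oracle :: "recf \<Rightarrow> recf \<Rightarrow> recf" where
  "subst_oracle e Oracle = e"
| "subst_oracle e (Comp f gs) = Comp (subst_oracle e f) (map (subst_oracle e) gs)"
| "subst_oracle e (Rec f g) = Rec (subst_oracle e f) (subst_oracle e g)"
| "subst_oracle e (Mu f) = Mu (subst_oracle e f)"
| "subst_oracle e f = f"

lemma eval_subst_oracle: "eval B f xs y \<Longrightarrow> decides A e B \<Longrightarrow> eval A (subst_oracle e f) xs y"
proof (induction rule: eval.induct)
  case (eval_Oracle x)
  then show ?case by (simp add: decides_def)
next
  case (eval_Comp xs gs ys f z)
  then have "list_all2 (\<lambda>g y. eval A g xs y) (map (subst_oracle e) gs) ys"
    by (auto simp: list_all2_conv_all_nth)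
  with eval_Comp show ?case by (auto intro: eval.eval_Comp)
next
  case (eval_Mu f n xs)
  then have "\<forall>m<n. \<exists>y. eval A (subst_oracle e f) (m # xs) (Suc y)" by fastforce
  with eval_Mu show ?case by (auto intro: eval.eval_Mu)
qed (auto intro: eval.intros)

lemma turing_reducible_refl: "A \<le>\<^sub>T A"
  unfolding turing_reducible_def decides_def by (blast intro: eval_Oracle)

lemma turing_reducible_trans: "C \<le>\<^sub>T B \<Longrightarrow> B \<le>\<^sub>T A \<Longrightarrow> C \<le>\<^sub>T A"
  unfolding turing_reducible_def decides_def[of _ _ C] by (blast intro: eval_subst_oracle)

lemma oracle_free_subst_oracle: "oracle_free e \<Longrightarrow> oracle_free (subst_oracle e f)"
  by (induction e f rule: subst_oracle.induct) auto

lemma computable_iff_reducible_empty: "computable C \<longleftrightarrow> C \<le>\<^sub>T {}"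
proof
  assume "C \<le>\<^sub>T {}"
  then obtain e where e: "decides {} e C" by (auto simp: turing_reducible_def)
  have "decides {} Zero {}" by (simp add: decides_def eval_Zero)
  with e have "decides {} (subst_oracle Zero e) C"
    unfolding decides_def[of _ _ C] by (blast intro: eval_subst_oracle)
  moreover have "oracle_free (subst_oracle Zero e)" by (simp add: oracle_free_subst_oracle)
  ultimately show "computable C" by (auto simp: computable_def)
qed (auto simp: computable_def turing_reducible_def)


section \<open>Turing degrees\<close>

definition turing_equiv :: "(nat set \<times> nat set) set" where
  "turing_equiv = {(A, B). A \<le>\<^sub>T B \<and> B \<le>\<^sub>T A}"

lemma equiv_turing_equiv: "equiv UNIV turing_equiv"
  unfolding turing_equiv_def
  by (intro equivI refl_onI symI transI)
    (auto intro: turing_reducible_refl elim: turing_reducible_trans)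

definition turing_degrees :: "nat set set set" where
  "turing_degrees = UNIV // turing_equiv"

definition zero_degree :: "nat set set" where
  "zero_degree = {C. computable C}"

lemma zero_degree_eq: "zero_degree = turing_equiv `` {{}}"
proof -
  have "{} \<le>\<^sub>T A" for A
    unfolding turing_reducible_def decides_def by (auto intro!: exI[of _ Zero] eval_Zero)
  then show ?thesis
    by (auto simp: zero_degree_def turing_equiv_def computable_iff_reducible_empty)
qed

lemma zero_degree_in_turing_degrees: "zero_degree \<in> turing_degrees"
  by (simp add: zero_degree_eq turing_degrees_def quotientI)


section \<open>Density and coarse computability\<close>

definition has_density :: "nat set \<Rightarrow> real \<Rightarrow> bool" where
  "has_density S r \<longleftrightarrow> (\<lambda>n. real (card (S \<inter> {0..n})) / real (n + 1)) \<longlonglongrightarrow> r"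

definition coarsely_computable :: "nat set \<Rightarrow> bool" where
  "coarsely_computable A \<longleftrightarrow> (\<exists>C. computable C \<and> has_density ((A - C) \<union> (C - A)) 0)"

end

theory Submission
  imports Defs
begin

text \<open>
  Blow every \<open>n\<close> up to the block \<open>{3 ^ (n - 1)..<3 ^ n}\<close> (to \<open>{0}\<close> for \<open>n = 0\<close>), and let the
  expansion of \<open>A\<close> be the union of the blocks of the elements of \<open>A\<close>. This set has the same degree
  as \<open>A\<close>, because the block of a given number can be computed and \<open>3 ^ n - 1\<close> lies in the \<open>n\<close>-th
  block.

  For \<open>n > 0\<close> the \<open>n\<close>-th block takes up two thirds of \<open>{..<3 ^ n}\<close>. If \<open>C\<close> differs from the expansion only on a
  set of density 0, then for all large \<open>n\<close> the majority of \<open>{..<3 ^ n}\<close> lies in \<open>C\<close> if and only if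
  \<open>n \<in> A\<close>: the numbers below the block and the numbers at which \<open>C\<close> is wrong are together too few
  to change the outcome. So counting the elements of \<open>C\<close> below \<open>3 ^ n\<close> computes \<open>A\<close> up to finitely
  many values (\<open>reducible_to_coarse_expansion\<close>), and if \<open>C\<close> is computable, then so is \<open>A\<close>. In a
  nonzero degree, the expansion of any member is therefore a member that is not coarsely computable.
\<close>

section \<open>Total functions computable in an oracle\<close>

definition computable_in :: "nat set \<Rightarrow> nat \<Rightarrow> (nat list \<Rightarrow> nat) \<Rightarrow> bool" where
  "computable_in A k f \<longleftrightarrow> (\<exists>e. \<forall>xs. length xs = k \<longrightarrow> eval A e xs (f xs))"

lemma turing_reducible_iff_computable_in:
  "B \<le>\<^sub>T A \<longleftrightarrow> computable_in A 1 (\<lambda>xs. of_bool (xs ! 0 \<in> B))"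
proof -
  have "(\<forall>xs. length xs = 1 \<longrightarrow> P xs) \<longleftrightarrow> (\<forall>x. P [x])" for P :: "nat list \<Rightarrow> bool"
    by (auto simp: length_Suc_conv)
  then show ?thesis
    by (simp add: turing_reducible_def decides_def computable_in_def)
qed

lemma computable_in_cong:
  "(\<And>xs. length xs = k \<Longrightarrow> f xs = g xs) \<Longrightarrow> computable_in A k f \<longleftrightarrow> computable_in A k g"
  unfolding computable_in_def by (intro ex_cong1) auto

lemma computable_in_zero: "computable_in A k (\<lambda>_. 0)"
  unfolding computable_in_def by (blast intro: eval_Zero)

lemma computable_in_nth: "i < k \<Longrightarrow> computable_in A k (\<lambda>xs. xs ! i)"
  unfolding computable_in_def by (blast intro: eval_Proj)

lemma computable_in_comp:
  assumes f: "computable_in A (length gs) f" and gs: "\<forall>g\<in>set gs. computable_in A k g"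
  shows "computable_in A k (\<lambda>xs. f (map (\<lambda>g. g xs) gs))"
proof -
  obtain e where e: "\<And>ys. length ys = length gs \<Longrightarrow> eval A e ys (f ys)"
    using f unfolding computable_in_def by blast
  obtain c where c: "\<And>g xs. g \<in> set gs \<Longrightarrow> length xs = k \<Longrightarrow> eval A (c g) xs (g xs)"
    using gs unfolding computable_in_def by metis
  have "eval A (Comp e (map c gs)) xs (f (map (\<lambda>g. g xs) gs))" if "length xs = k" for xs
    by (rule eval_Comp[OF _ e]) (auto simp: list_all2_conv_all_nth c that)
  then show ?thesis
    unfolding computable_in_def by blast
qed

lemma computable_in_comp1:
  assumes "computable_in A 1 (\<lambda>xs. f (xs ! 0))" and "computable_in A k g"
  shows "computable_in A k (\<lambda>xs. f (g xs))"
  using computable_in_comp[of A "[g]" "\<lambda>xs. f (xs ! 0)" k] assms by simp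

lemma computable_in_Suc: "computable_in A k f \<Longrightarrow> computable_in A k (\<lambda>xs. Suc (f xs))"
proof (erule computable_in_comp1[rotated])
  show "computable_in A 1 (\<lambda>xs. Suc (xs ! 0))"
    unfolding computable_in_def by (auto simp: length_Suc_conv intro!: exI[of _ Succ] eval_Succ)
qed

lemma computable_in_oracle:
  "computable_in A k f \<Longrightarrow> computable_in A k (\<lambda>xs. of_bool (f xs \<in> A))"
  by (rule computable_in_comp1[where f = "\<lambda>x. of_bool (x \<in> A)"])
    (simp_all only: turing_reducible_refl flip: turing_reducible_iff_computable_in)

lemma computable_in_const: "computable_in A k (\<lambda>_. c)"
  by (induction c) (simp_all add: computable_in_zero computable_in_Suc)

text \<open>
  The scheme \<open>Rec\<close> counts along its own first argument. Composing it with \<open>h\<close> and all projections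
  lets the number of steps be any computable function of the parameters, so that the arithmetic
  functions below can be obtained as closure properties.
\<close>

lemma computable_in_rec_nat:
  assumes f: "computable_in A k f"
    and g: "computable_in A (Suc (Suc k)) (\<lambda>zs. g (zs ! 0) (zs ! 1) (drop 2 zs))"
    and h: "computable_in A k h"
  shows "computable_in A k (\<lambda>xs. rec_nat (f xs) (\<lambda>n y. g n y xs) (h xs))"
proof -
  obtain e where e: "\<And>xs. length xs = k \<Longrightarrow> eval A e xs (f xs)"
    using f unfolding computable_in_def by blast
  obtain e' where e': "\<And>n y xs. length xs = k \<Longrightarrow> eval A e' (n # y # xs) (g n y xs)"
    using g unfolding computable_in_def by (metis (no_types, lifting) One_nat_def drop0 drop_Suc_Cons
        length_Cons nth_Cons_0 nth_Cons_Suc numeral_2_eq_2)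
  have "eval A (Rec e e') (n # xs) (rec_nat (f xs) (\<lambda>n y. g n y xs) n)" if "length xs = k" for n xs
    by (induction n) (auto intro: eval_Rec_0 eval_Rec_Suc e e' that)
  then have "computable_in A (Suc k) (\<lambda>zs. rec_nat (f (tl zs)) (\<lambda>n y. g n y (tl zs)) (hd zs))"
    unfolding computable_in_def by (intro exI[of _ "Rec e e'"]) (auto simp: length_Suc_conv)
  then have "computable_in A (length (h # map (\<lambda>i xs. xs ! i) [0..<k]))
      (\<lambda>zs. rec_nat (f (tl zs)) (\<lambda>n y. g n y (tl zs)) (hd zs))"
    by simp
  from computable_in_comp[OF this, of k] h computable_in_nth
  have "computable_in A k (\<lambda>xs. rec_nat (f (map (\<lambda>i. xs ! i) [0..<k]))
      (\<lambda>n y. g n y (map (\<lambda>i. xs ! i) [0..<k])) (h xs))"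
    by (auto simp: comp_def)
  then show ?thesis
    by (rule iffD1[OF computable_in_cong, rotated]) (auto simp: map_nth)
qed

lemma computable_in_Least:
  assumes p: "computable_in A (Suc k) (\<lambda>zs. p (hd zs) (tl zs))"
    and ex: "\<And>xs. \<exists>n. p n xs = 0"
  shows "computable_in A k (\<lambda>xs. LEAST n. p n xs = 0)"
proof -
  obtain e where e: "\<And>n xs. length xs = k \<Longrightarrow> eval A e (n # xs) (p n xs)"
    using p unfolding computable_in_def by (metis length_Cons list.sel(1,3))
  have "eval A (Mu e) xs (LEAST n. p n xs = 0)" if xs: "length xs = k" for xs
  proof (rule eval_Mu)
    show "eval A e ((LEAST n. p n xs = 0) # xs) 0"
      using e[OF xs] LeastI_ex[OF ex, of xs] by metis
    show "\<forall>m<LEAST n. p n xs = 0. \<exists>y. eval A e (m # xs) (Suc y)"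
      using e[OF xs] not_less_Least by (metis not0_implies_Suc)
  qed
  then show ?thesis
    unfolding computable_in_def by blast
qed

lemma computable_in_add:
  assumes "computable_in A k f" and "computable_in A k g"
  shows "computable_in A k (\<lambda>xs. f xs + g xs)"
proof -
  have "rec_nat x (\<lambda>_. Suc) y = x + y" for x y :: nat
    by (induction y) auto
  with computable_in_rec_nat[OF assms(1) _ assms(2), of "\<lambda>_ y _. Suc y"] show ?thesis
    by (simp add: computable_in_Suc computable_in_nth)
qed

lemma computable_in_pred:
  assumes "computable_in A k f"
  shows "computable_in A k (\<lambda>xs. f xs - 1)"
proof -
  have "rec_nat 0 (\<lambda>n _. n) y = y - 1" for y :: nat
    by (cases y) auto
  with computable_in_rec_nat[OF computable_in_zero _ assms, of "\<lambda>n _ _. n"] show ?thesis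
    by (simp add: computable_in_nth)
qed

lemma computable_in_diff:
  assumes "computable_in A k f" and "computable_in A k g"
  shows "computable_in A k (\<lambda>xs. f xs - g xs)"
proof -
  have "rec_nat x (\<lambda>_ z. z - 1) y = x - y" for x y :: nat
    by (induction y) auto
  with computable_in_rec_nat[OF assms(1) _ assms(2), of "\<lambda>_ z _. z - 1"] show ?thesis
    using computable_in_pred[OF computable_in_nth[of 1 "Suc (Suc k)" A]] by simp
qed

lemma computable_in_eq_0:
  assumes "computable_in A k f"
  shows "computable_in A k (\<lambda>xs. of_bool (f xs = 0))"
proof -
  have "rec_nat 1 (\<lambda>_ _. 0) y = (of_bool (y = 0) :: nat)" for y
    by (cases y) auto
  with computable_in_rec_nat[OF computable_in_const[of A k 1] _ assms, of "\<lambda>_ _ _. 0"]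
  show ?thesis
    by (simp add: computable_in_zero)
qed

lemma computable_in_power3:
  assumes "computable_in A k f"
  shows "computable_in A k (\<lambda>xs. 3 ^ f xs)"
proof -
  have "rec_nat 1 (\<lambda>_ y. y + y + y) n = (3 :: nat) ^ n" for n
    by (induction n) auto
  with computable_in_rec_nat[OF computable_in_const[of A k 1] _ assms, of "\<lambda>_ y _. y + y + y"]
  show ?thesis
    by (simp add: computable_in_add computable_in_nth)
qed

lemma computable_in_card_below:
  assumes "computable_in A k f"
  shows "computable_in A k (\<lambda>xs. card (A \<inter> {..<f xs}))"
proof -
  have "rec_nat 0 (\<lambda>n y. y + of_bool (n \<in> A)) m = card (A \<inter> {..<m})" for m
    by (induction m) (auto simp: lessThan_Suc)
  with computable_in_rec_nat[OF computable_in_zero _ assms, of "\<lambda>n y _. y + of_bool (n \<in> A)"]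
  show ?thesis
    by (simp add: computable_in_add computable_in_nth computable_in_oracle)
qed

text \<open>
  Finitely many values do not matter for reducibility: each step of the induction prepends one value
  of the characteristic function, as the base value of a recursion that ignores its previous value.
\<close>

lemma turing_reducible_of_shift: "{n. n + N \<in> B} \<le>\<^sub>T A \<Longrightarrow> B \<le>\<^sub>T A"
proof (induction N)
  case (Suc N)
  let ?b = "\<lambda>n. of_bool (n + N \<in> B) :: nat"
  have "computable_in A 1 (\<lambda>xs. ?b (Suc (xs ! 0)))"
    using Suc.prems by (simp add: turing_reducible_iff_computable_in)
  then have "computable_in A (Suc (Suc 1)) (\<lambda>zs. ?b (Suc (zs ! 0)))"
    by (rule computable_in_comp1[where f = "\<lambda>n. ?b (Suc n)"]) (simp add: computable_in_nth)
  from computable_in_rec_nat[OF computable_in_const[of A 1 "?b 0"] this computable_in_nth[of 0]]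
  have "computable_in A 1 (\<lambda>xs. rec_nat (?b 0) (\<lambda>n _. ?b (Suc n)) (xs ! 0))"
    by simp
  moreover have "rec_nat (?b 0) (\<lambda>n _. ?b (Suc n)) n = ?b n" for n
    by (cases n) simp_all
  ultimately show ?case
    by (intro Suc.IH) (simp add: turing_reducible_iff_computable_in)
qed simp


section \<open>The expansion of a set\<close>

definition block_index :: "nat \<Rightarrow> nat" where
  "block_index x = (LEAST n. x < 3 ^ n)"

definition expansion :: "nat set \<Rightarrow> nat set" where
  "expansion A = {x. block_index x \<in> A}"

lemma less_power3: "n < (3 :: nat) ^ n"
  by (rule less_exp[THEN less_le_trans]) (simp add: power_mono)

lemma block_index_eq:
  assumes "x < 3 ^ n" and "3 ^ (n - 1) \<le> x \<or> n = 0"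
  shows "block_index x = n"
  unfolding block_index_def
proof (rule Least_equality)
  fix m :: nat
  assume m: "x < 3 ^ m"
  show "n \<le> m"
  proof (rule ccontr)
    assume "\<not> n \<le> m"
    then have "(3 :: nat) ^ m \<le> 3 ^ (n - 1)" and "n \<noteq> 0"
      by (auto intro: power_increasing)
    with m assms(2) show False by linarith
  qed
qed (fact assms(1))

lemma expansion_reducible: "expansion A \<le>\<^sub>T A"
proof -
  have "\<exists>n. Suc (xs ! 0) - 3 ^ n = 0" for xs :: "nat list"
    using less_power3[of "xs ! 0"] by (intro exI[of _ "xs ! 0"]) simp
  moreover have "computable_in A (Suc 1) (\<lambda>zs. Suc (zs ! 1) - 3 ^ (zs ! 0))"
    by (intro computable_in_diff computable_in_Suc computable_in_power3 computable_in_nth) simp_all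
  then have "computable_in A (Suc 1) (\<lambda>zs. Suc (tl zs ! 0) - 3 ^ hd zs)"
    by (rule iffD1[OF computable_in_cong, rotated]) (auto simp: length_Suc_conv)
  ultimately have "computable_in A 1 (\<lambda>xs. LEAST n. Suc (xs ! 0) - 3 ^ n = 0)"
    by (intro computable_in_Least[where p = "\<lambda>n xs. Suc (xs ! 0) - 3 ^ n"])
  then have "computable_in A 1 (\<lambda>xs. block_index (xs ! 0))"
    by (simp add: block_index_def less_eq_Suc_le)
  then show ?thesis
    by (simp add: turing_reducible_iff_computable_in expansion_def computable_in_oracle)
qed

lemma reducible_expansion: "A \<le>\<^sub>T expansion A"
proof -
  have "block_index (3 ^ n - 1) = n" for n
    by (rule block_index_eq) (cases n; simp)+
  then have *: "3 ^ n - 1 \<in> expansion A \<longleftrightarrow> n \<in> A" for n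
    by (simp add: expansion_def)
  have "computable_in (expansion A) 1 (\<lambda>xs. of_bool (3 ^ (xs ! 0) - 1 \<in> expansion A))"
    by (intro computable_in_oracle computable_in_pred computable_in_power3 computable_in_nth) simp
  then show ?thesis
    by (simp only: turing_reducible_iff_computable_in *)
qed


section \<open>Decoding by majority\<close>

text \<open>
  With \<open>q = 3 ^ n\<close>, the \<open>Suc n\<close>-th block consists of \<open>2 * q\<close> of the \<open>3 * q\<close> numbers below
  \<open>3 ^ Suc n\<close>. Fewer than \<open>q / 2\<close> errors leave \<open>C\<close> more than \<open>3 * q / 2\<close> elements there when the
  block belongs to the expansion, and fewer than \<open>q + q / 2\<close> otherwise.
\<close>

lemma majority_iff:
  assumes few: "2 * card (((expansion A - C) \<union> (C - expansion A)) \<inter> {..<3 ^ Suc n}) < 3 ^ n"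
  shows "3 ^ Suc n \<le> 2 * card (C \<inter> {..<3 ^ Suc n}) \<longleftrightarrow> Suc n \<in> A"
proof -
  define q :: nat where "q = 3 ^ n"
  define D where "D = ((expansion A - C) \<union> (C - expansion A)) \<inter> {..<3 * q}"
  define E where "E = C \<inter> {..<3 * q}"
  have fin: "finite D" "finite E"
    by (simp_all add: D_def E_def)
  have D: "2 * card D < q"
    using few by (simp add: D_def q_def)
  have block: "x \<in> expansion A \<longleftrightarrow> Suc n \<in> A" if "q \<le> x" "x < 3 * q" for x
    using block_index_eq[of x "Suc n"] that by (simp add: expansion_def q_def)
  have "3 * q \<le> 2 * card E \<longleftrightarrow> Suc n \<in> A"
  proof (cases "Suc n \<in> A")
    case True
    then have "{q..<3 * q} \<subseteq> E \<union> D"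
      using block by (auto simp: D_def E_def)
    then have "card {q..<3 * q} \<le> card (E \<union> D)"
      by (rule card_mono[rotated]) (simp add: fin)
    also have "\<dots> \<le> card E + card D"
      by (rule card_Un_le)
    finally show ?thesis
      using D True by simp
  next
    case False
    then have "E \<subseteq> {..<q} \<union> D"
      using block by (auto simp: D_def E_def not_less)
    then have "card E \<le> card ({..<q} \<union> D)"
      by (rule card_mono[rotated]) (simp add: fin)
    also have "\<dots> \<le> q + card D"
      using card_Un_le[of "{..<q}" D] by simp
    finally show ?thesis
      using D False by simp
  qed
  then show ?thesis
    by (simp add: q_def E_def)
qed

lemma has_density_0_eventually_few:
  assumes "has_density S 0"
  shows "\<exists>N. \<forall>n\<ge>N. 2 * card (S \<inter> {..<3 ^ Suc n}) < 3 ^ n"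
proof -
  \<comment> \<open>A sixth of \<open>3 ^ Suc n\<close> is half of \<open>3 ^ n\<close>.\<close>
  have "eventually (\<lambda>m. real (card (S \<inter> {0..m})) / real (m + 1) < 1 / 6) sequentially"
    using assms unfolding has_density_def by (rule order_tendstoD(2)) simp
  then obtain N where N: "\<And>m. m \<ge> N \<Longrightarrow> real (card (S \<inter> {0..m})) / real (m + 1) < 1 / 6"
    by (auto simp: eventually_sequentially)
  have "2 * card (S \<inter> {..<3 ^ Suc n}) < 3 ^ n" if "n \<ge> N" for n
  proof -
    define m :: nat where "m = 3 ^ Suc n - 1"
    have m: "m + 1 = 3 ^ Suc n"
      by (simp add: m_def)
    then have "m \<ge> N"
      using less_power3[of "Suc n"] that by linarith
    from N[OF this] have "6 * real (card (S \<inter> {0..m})) < real (m + 1)"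
      by (simp add: field_simps)
    then have "6 * card (S \<inter> {0..m}) < 3 ^ Suc n"
      unfolding m by linarith
    moreover have "{0..m} = {..<3 ^ Suc n}"
      using m by auto
    ultimately show ?thesis
      by simp
  qed
  then show ?thesis
    by blast
qed

lemma reducible_to_coarse_expansion:
  assumes "has_density ((expansion A - C) \<union> (C - expansion A)) 0"
  shows "A \<le>\<^sub>T C"
proof -
  obtain N where N: "\<And>n. n \<ge> N \<Longrightarrow>
      2 * card (((expansion A - C) \<union> (C - expansion A)) \<inter> {..<3 ^ Suc n}) < 3 ^ n"
    using has_density_0_eventually_few[OF assms] by blast
  let ?c = "\<lambda>n. card (C \<inter> {..<3 ^ (n + Suc N)})"
  have *: "3 ^ (n + Suc N) - (?c n + ?c n) = 0 \<longleftrightarrow> n + Suc N \<in> A" for n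
    using majority_iff[OF N[of "n + N"]] by (simp add: mult_2)
  have "computable_in C 1 (\<lambda>xs. of_bool (3 ^ (xs ! 0 + Suc N) - (?c (xs ! 0) + ?c (xs ! 0)) = 0))"
    by (intro computable_in_eq_0 computable_in_diff computable_in_add computable_in_card_below
        computable_in_power3 computable_in_nth computable_in_const) simp_all
  then have "computable_in C 1 (\<lambda>xs. of_bool (xs ! 0 + Suc N \<in> A))"
    by (simp only: *)
  then have "{n. n + Suc N \<in> A} \<le>\<^sub>T C"
    by (simp only: turing_reducible_iff_computable_in mem_Collect_eq)
  then show ?thesis
    by (rule turing_reducible_of_shift)
qed

lemma coarsely_computable_expansion_imp_computable:
  assumes "coarsely_computable (expansion A)"
  shows "computable A"
  using assms reducible_to_coarse_expansion turing_reducible_trans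
  unfolding coarsely_computable_def computable_iff_reducible_empty by blast

theorem theorem2p20:
  shows "\<forall>d\<in>turing_degrees. d \<noteq> zero_degree \<longrightarrow> (\<exists>A\<in>d. \<not> coarsely_computable A)"
proof (intro ballI impI)
  fix d
  assume "d \<in> turing_degrees" and nonzero: "d \<noteq> zero_degree"
  then obtain A where d: "d = turing_equiv `` {A}"
    by (auto simp: turing_degrees_def elim: quotientE)
  have "\<not> computable A"
  proof
    assume "computable A"
    then have "({}, A) \<in> turing_equiv"
      using zero_degree_eq by (auto simp: zero_degree_def)
    with nonzero show False
      using equiv_class_eq[OF equiv_turing_equiv] by (metis d zero_degree_eq)
  qed
  moreover have "expansion A \<in> d"
    by (simp add: d turing_equiv_def expansion_reducible reducible_expansion)
  ultimately show "\<exists>A\<in>d. \<not> coarsely_computable A"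
    using coarsely_computable_expansion_imp_computable by blast
qed

end
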